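(* Let $G$ be a countable group in which the normalizer $N_G(H)$ of any non-central finite subgroup $H$ has infinite index in $G$. Suppose that $G$ acts spherically transitively on a rooted tree $\mathcal T$. If there exists a subtree $v\mathcal T$ (with $v$ a vertex of $\mathcal T$) whose stabilizer $\mathrm{Stab}_G(v\mathcal T)$ in $G$ is not trivial, then the $*$-homomorphism $\rho_{\mathcal T}:\mathbb C G\to\mathcal B(\ell^2(\mathcal T^0))$ is not faithful (i.e. not injective). In particular, the regular representation $\lambda$ of $G$ is not weakly contained in $\rho_{\mathcal T}$.
   Context: Rooted tree: given a sequence $\bar d=d_0,d_1,\dots$ of integers $d_i\geq 2$, the rooted tree $\mathcal T=\mathcal T_{\bar d}$ is the infinite locally finite tree with a distinguished vertex $\varnothing$ (the root) of degree $d_0$ in which every vertex at distance $n\geq1$ from the root has degree $d_n+1$. $\mathcal T^0$ is its set of vertices and the $n$-th level $L_n$ is the set of vertices at distance $n$ from the root. For $v\in\mathcal T^0$, the subtree $v\mathcal T$ is the connected subgraph whose vertices are the descendants of $v$, i.e. the vertices $w$ such that $v$ lies on the geodesic path from $\varnothing$ to $w$. An action of a countable group $G$ on $\mathcal T$ is an action by graph automorphisms fixing the root; it is spherically transitive if $G$ acts transitively on each level $L_n$. The action induces the unitary representation $\rho_{\mathcal T}$ of $G$ on $\ell^2(\mathcal T^0)$, $\rho_{\mathcal T}(g)(\xi)(v)=\xi(g^{-1}\cdot v)$, which extends linearly to a $*$-homomorphism, still denoted $\rho_{\mathcal T}$, on the group algebra $\mathbb C G$. For $v\in\mathcal T^0$,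 $\mathrm{Stab}_G(v\mathcal T):=\{g\in G\mid g(x)=x\ \text{for all vertices } x\in v\mathcal T\}$. A subgroup is central if it is contained in the centre of $G$. The regular representation $\lambda$ of $G$ on $\ell^2(G)$ is $\lambda(g)(\xi)(h)=\xi(g^{-1}h)$. Weak containment: $\pi_1$ is weakly contained in $\pi_2$, for unitary representations $(\pi_1,\mathcal H_1)$, $(\pi_2,\mathcal H_2)$ of $G$, if for all $\epsilon>0$, $\xi\in\mathcal H_1$ and finite $K\subset G$ there are vectors $\nu_1,\dots,\nu_m\in\mathcal H_2$ such that for all $g\in K$, $\left|\langle \pi_1(g)\xi\,|\,\xi\rangle-\sum_{i=1}^m\langle\pi_2(g)\nu_i\,|\,\nu_i\rangle\right|<\epsilon$. *)

theory Defs
  imports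
    "HOL-Analysis.Infinite_Sum"
    "HOL-Algebra.Group_Action"
    "HOL-Library.Countable_Set"
    "HOL-Library.Poly_Mapping"
begin

section \<open>Rooted trees\<close>

record 'v rooted_graph =
  verts :: "'v set"
  adj :: "'v \<Rightarrow> 'v \<Rightarrow> bool"
  root :: 'v

definition simple_rooted_graph :: "'v rooted_graph \<Rightarrow> bool" where
  "simple_rooted_graph T \<longleftrightarrow>
     root T \<in> verts T \<and>
     (\<forall>u w. adj T u w \<longrightarrow> u \<in> verts T \<and> w \<in> verts T \<and> u \<noteq> w \<and> adj T w u)"

definition walk :: "'v rooted_graph \<Rightarrow> 'v \<Rightarrow> 'v list \<Rightarrow> 'v \<Rightarrow> bool" where
  "walk T u p w \<longleftrightarrow>
     p \<noteq> [] \<and> hd p = u \<and> last p = w \<and> set p \<subseteq> verts T \<and> successively (adj T) p"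

definition is_tree :: "'v rooted_graph \<Rightarrow> bool" where
  "is_tree T \<longleftrightarrow>
     simple_rooted_graph T \<and>
     (\<forall>u\<in>verts T. \<forall>w\<in>verts T. \<exists>p. walk T u p w) \<and>
     \<not> (\<exists>u p w. walk T u p w \<and> distinct p \<and> length p \<ge> 3 \<and> adj T w u)"

(* A walk is listed by its vertices, so it has one edge fewer than its list has entries. *)
definition graph_dist :: "'v rooted_graph \<Rightarrow> 'v \<Rightarrow> 'v \<Rightarrow> nat" where
  "graph_dist T u w = (LEAST n. \<exists>p. walk T u p w \<and> length p = Suc n)"

definition geodesic :: "'v rooted_graph \<Rightarrow> 'v \<Rightarrow> 'v list \<Rightarrow> 'v \<Rightarrow> bool" where
  "geodesic T u p w \<longleftrightarrow> walk T u p w \<and> length p = Suc (graph_dist T u w)"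

definition degree :: "'v rooted_graph \<Rightarrow> 'v \<Rightarrow> nat" where
  "degree T u = card {w. adj T u w}"

(* Since d n \<ge> 2, no degree is 0, so the degree condition makes all neighbourhoods
   finite (card of an infinite set is 0) and the tree infinite. *)
definition rooted_tree :: "(nat \<Rightarrow> nat) \<Rightarrow> 'v rooted_graph \<Rightarrow> bool" where
  "rooted_tree d T \<longleftrightarrow>
     (\<forall>n. d n \<ge> 2) \<and> is_tree T \<and>
     degree T (root T) = d 0 \<and>
     (\<forall>u\<in>verts T. \<forall>n\<ge>1. graph_dist T (root T) u = n \<longrightarrow> degree T u = d n + 1)"

definition level :: "'v rooted_graph \<Rightarrow> nat \<Rightarrow> 'v set" where
  "level T n = {u \<in> verts T. graph_dist T (root T) u = n}"

definition descendants :: "'v rooted_graph \<Rightarrow> 'v \<Rightarrow> 'v set" where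
  "descendants T v = {w \<in> verts T. \<exists>p. geodesic T (root T) p w \<and> v \<in> set p}"


section \<open>Group actions on rooted trees\<close>

definition tree_action ::
    "('g, 'm) monoid_scheme \<Rightarrow> 'v rooted_graph \<Rightarrow> ('g \<Rightarrow> 'v \<Rightarrow> 'v) \<Rightarrow> bool" where
  "tree_action G T \<phi> \<longleftrightarrow>
     group_action G (verts T) \<phi> \<and>
     (\<forall>g\<in>carrier G. \<phi> g (root T) = root T \<and>
        (\<forall>u\<in>verts T. \<forall>w\<in>verts T. adj T (\<phi> g u) (\<phi> g w) \<longleftrightarrow> adj T u w))"

definition spherically_transitive ::
    "('g, 'm) monoid_scheme \<Rightarrow> 'v rooted_graph \<Rightarrow> ('g \<Rightarrow> 'v \<Rightarrow> 'v) \<Rightarrow> bool" where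
  "spherically_transitive G T \<phi> \<longleftrightarrow>
     (\<forall>n. \<forall>u\<in>level T n. \<forall>w\<in>level T n. \<exists>g\<in>carrier G. \<phi> g u = w)"

definition subtree_stabilizer ::
    "('g, 'm) monoid_scheme \<Rightarrow> 'v rooted_graph \<Rightarrow> ('g \<Rightarrow> 'v \<Rightarrow> 'v) \<Rightarrow> 'v \<Rightarrow> 'g set" where
  "subtree_stabilizer G T \<phi> v = {g \<in> carrier G. \<forall>x\<in>descendants T v. \<phi> g x = x}"

definition group_center :: "('g, 'm) monoid_scheme \<Rightarrow> 'g set" where
  "group_center G = {z \<in> carrier G. \<forall>g\<in>carrier G. z \<otimes>\<^bsub>G\<^esub> g = g \<otimes>\<^bsub>G\<^esub> z}"


section \<open>Unitary representations\<close>

(* The Hilbert space l^2(X): square-summable functions on X, extended by 0 outside X. *)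
definition ell2 :: "'x set \<Rightarrow> ('x \<Rightarrow> complex) set" where
  "ell2 X = {\<xi>. (\<forall>x. x \<notin> X \<longrightarrow> \<xi> x = 0) \<and> (\<lambda>x. (cmod (\<xi> x))\<^sup>2) summable_on X}"

definition ell2_inner :: "('x \<Rightarrow> complex) \<Rightarrow> ('x \<Rightarrow> complex) \<Rightarrow> complex" where
  "ell2_inner \<xi> \<eta> = (\<Sum>\<^sub>\<infinity>x. \<xi> x * cnj (\<eta> x))"

definition tree_rep ::
    "('g, 'm) monoid_scheme \<Rightarrow> 'v rooted_graph \<Rightarrow> ('g \<Rightarrow> 'v \<Rightarrow> 'v)
      \<Rightarrow> 'g \<Rightarrow> ('v \<Rightarrow> complex) \<Rightarrow> ('v \<Rightarrow> complex)" where
  "tree_rep G T \<phi> g \<xi> = (\<lambda>v. if v \<in> verts T then \<xi> (\<phi> (inv\<^bsub>G\<^esub> g) v) else 0)"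

definition regular_rep ::
    "('g, 'm) monoid_scheme \<Rightarrow> 'g \<Rightarrow> ('g \<Rightarrow> complex) \<Rightarrow> ('g \<Rightarrow> complex)" where
  "regular_rep G g \<xi> = (\<lambda>h. if h \<in> carrier G then \<xi> (inv\<^bsub>G\<^esub> g \<otimes>\<^bsub>G\<^esub> h) else 0)"

(* The underlying vector space of the complex group algebra. *)
definition group_algebra :: "('g, 'm) monoid_scheme \<Rightarrow> ('g \<Rightarrow>\<^sub>0 complex) set" where
  "group_algebra G = {a. Poly_Mapping.keys a \<subseteq> carrier G}"

(* The operator \<Sum>g. a g * \<pi> g on ell2 X. It is restricted to ell2 X so that equality of
   HOL functions is equality of operators on ell2 X. *)
definition algebra_rep ::
    "'x set \<Rightarrow> ('g \<Rightarrow> ('x \<Rightarrow> complex) \<Rightarrow> ('x \<Rightarrow> complex))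
      \<Rightarrow> ('g \<Rightarrow>\<^sub>0 complex) \<Rightarrow> ('x \<Rightarrow> complex) \<Rightarrow> ('x \<Rightarrow> complex)" where
  "algebra_rep X \<pi> a =
     (\<lambda>\<xi>\<in>ell2 X. \<lambda>x. \<Sum>g\<in>Poly_Mapping.keys a. Poly_Mapping.lookup a g * \<pi> g \<xi> x)"

(* Weak containment of (\<pi>1, H1) in (\<pi>2, H2); ip1 and ip2 are the inner products of
   the Hilbert spaces H1 and H2. *)
definition weakly_contained ::
    "('g, 'm) monoid_scheme
      \<Rightarrow> 'h1 set \<Rightarrow> ('h1 \<Rightarrow> 'h1 \<Rightarrow> complex) \<Rightarrow> ('g \<Rightarrow> 'h1 \<Rightarrow> 'h1)
      \<Rightarrow> 'h2 set \<Rightarrow> ('h2 \<Rightarrow> 'h2 \<Rightarrow> complex) \<Rightarrow> ('g \<Rightarrow> 'h2 \<Rightarrow> 'h2) \<Rightarrow> bool" where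
  "weakly_contained G H1 ip1 \<pi>1 H2 ip2 \<pi>2 \<longleftrightarrow>
     (\<forall>\<epsilon>>0. \<forall>\<xi>\<in>H1. \<forall>K. finite K \<and> K \<subseteq> carrier G \<longrightarrow>
        (\<exists>\<nu>s. set \<nu>s \<subseteq> H2 \<and>
           (\<forall>g\<in>K. cmod (ip1 (\<pi>1 g \<xi>) \<xi> - (\<Sum>\<nu>\<leftarrow>\<nu>s. ip2 (\<pi>2 g \<nu>) \<nu>)) < \<epsilon>)))"

end

theory Submission
  imports Defs
begin

text \<open>
  Both claims follow from one element \<open>a\<close> of the group algebra whose coefficient at the identity
  is 1 and which acts as zero in the tree representation. It is a nonzero element of the kernel
  (\<open>not_faithful_of_annihilator\<close>); and it separates the two representations, because the linear
  functional given by \<open>a\<close> vanishes on every matrix coefficient of the tree representation but takes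
  the value 1 on the coefficient of the regular representation at the point mass of the identity
  (\<open>not_weakly_contained_of_annihilator\<close>).

  Let \<open>v\<close> be a vertex of level \<open>n\<close> whose subtree has a nontrivial stabilizer \<open>S\<close>. The stabilizers
  of the subtrees below the other vertices of level \<open>n\<close> are conjugate to \<open>S\<close>.

  If \<open>S\<close> is infinite, let \<open>N\<close> be the finite-index subgroup that fixes the finitely many vertices
  of level at most \<open>n\<close>. Each subtree stabilizer at level \<open>n\<close> meets \<open>N\<close> in an infinite set. For
  \<open>x\<close> in such an intersection, \<open>1 - x\<close> kills the functions on the subtree in question and on the
  levels up to \<open>n\<close>, and all elements of \<open>N\<close> preserve that subtree. So the product of factors
  \<open>1 - x\<close>, one for each vertex of level \<open>n\<close>, kills everything. Multiplying by \<open>1 - x\<close> does not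
  change the coefficient at the identity unless the inverse of \<open>x\<close> is in the finite support of the
  product so far; infinitely many choices of \<open>x\<close> are available at each step, so this is avoided
  (\<open>exists_annihilator\<close>).

  If \<open>S\<close> is finite, it is central: its normalizer contains the stabilizer of \<open>v\<close>, which has finite
  index, so the hypothesis on normalizers excludes the noncentral case. A central \<open>S\<close> equals its
  conjugates and so fixes everything from level \<open>n\<close> on; parents in a tree are unique, so it fixes
  the levels above as well. Every \<open>k \<noteq> 1\<close> in \<open>S\<close> thus acts trivially, and \<open>a = 1 - k\<close> works.
\<close>

section \<open>Walks and parents in trees\<close>

lemma walk_append:
  assumes "walk T u p x" "walk T x q w"
  shows "walk T u (p @ tl q) w"
proof (cases q)
  case Nil
  then show ?thesis using assms by (simp add: walk_def)
next
  case (Cons y q')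
  then show ?thesis using assms
    by (cases "q' = []") (auto simp: walk_def successively_append_iff successively_Cons)
qed

lemma walk_rev:
  assumes "simple_rooted_graph T" "walk T u p w"
  shows "walk T w (rev p) u"
proof -
  have "successively (\<lambda>x y. adj T y x) p"
  proof (rule successively_mono)
    show "successively (adj T) p" using assms by (simp add: walk_def)
  qed (use assms in \<open>auto simp: simple_rooted_graph_def\<close>)
  then show ?thesis using assms by (auto simp: walk_def hd_rev last_rev)
qed

lemma walk_take:
  assumes "walk T u p w" "i < length p"
  shows "walk T u (take (Suc i) p) (p ! i)"
proof -
  have "successively (adj T) (take (Suc i) p @ drop (Suc i) p)"
    using assms by (simp add: walk_def)
  moreover have "last (take (Suc i) p) = p ! i"
    using assms by (simp add: take_Suc_conv_app_nth)
  ultimately show ?thesis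
    using assms set_take_subset[of "Suc i" p] unfolding walk_def successively_append_iff
    by (auto simp: hd_take)
qed

lemma walk_drop:
  assumes "walk T u p w" "i < length p"
  shows "walk T (p ! i) (drop i p) w"
proof -
  have "successively (adj T) (take i p @ drop i p)"
    using assms by (simp add: walk_def)
  then show ?thesis
    using assms set_drop_subset[of i p] unfolding walk_def successively_append_iff
    by (auto simp: hd_drop_conv_nth)
qed

text \<open>A vertex that is visited twice bounds a closed detour, which can be cut out.\<close>
lemma walk_imp_distinct_walk:
  "walk T u p w \<Longrightarrow> \<exists>q. walk T u q w \<and> distinct q \<and> set q \<subseteq> set p"
proof (induction "length p" arbitrary: p rule: less_induct)
  case less
  show ?case
  proof (cases "distinct p")
    case True
    then show ?thesis using less.prems by blast
  next
    case False
    then obtain xs y ys zs where p: "p = xs @ [y] @ ys @ [y] @ zs"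
      using not_distinct_decomp by blast
    let ?q = "xs @ [y] @ zs"
    have "walk T u ?q w"
      using less.prems p
      by (auto simp: walk_def successively_append_iff successively_Cons hd_append split: if_splits)
    moreover have "length ?q < length p" using p by simp
    moreover have "set ?q \<subseteq> set p" using p by auto
    ultimately show ?thesis using less.hyps[of ?q] by blast
  qed
qed

lemma graph_dist_le: "walk T u p w \<Longrightarrow> graph_dist T u w \<le> length p - 1"
  unfolding graph_dist_def
  by (rule Least_le) (auto simp: walk_def)

lemma geodesic_exists:
  assumes "is_tree T" "u \<in> verts T" "w \<in> verts T"
  obtains p where "geodesic T u p w"
proof -
  obtain p where p: "walk T u p w" using assms unfolding is_tree_def by blast
  then have "\<exists>p. walk T u p w \<and> length p = Suc (length p - 1)"
    by (auto simp: walk_def)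
  then have "\<exists>n p. walk T u p w \<and> length p = Suc n"
    using p by (metis Suc_pred length_greater_0_conv walk_def)
  from LeastI_ex[OF this] show ?thesis
    using that by (auto simp: geodesic_def graph_dist_def)
qed

text \<open>A shorter walk to an intermediate vertex, continued along the rest of \<open>p\<close>, would beat the
  geodesic \<open>p\<close>.\<close>
lemma geodesic_nth_dist:
  assumes "is_tree T" "geodesic T u p w" "i < length p"
  shows "graph_dist T u (p ! i) = i"
proof (rule antisym)
  have p: "walk T u p w" "length p = Suc (graph_dist T u w)"
    using assms(2) by (auto simp: geodesic_def)
  show "graph_dist T u (p ! i) \<le> i"
    using graph_dist_le[OF walk_take[OF p(1) assms(3)]] assms(3) by simp
  have "u \<in> verts T" "p ! i \<in> verts T"
    using p(1) assms(3) by (auto simp: walk_def)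
  then obtain q where q: "geodesic T u q (p ! i)"
    using geodesic_exists[OF assms(1)] by metis
  then have "walk T u (q @ tl (drop i p)) w"
    using walk_append walk_drop[OF p(1) assms(3)] unfolding geodesic_def by metis
  from graph_dist_le[OF this] show "i \<le> graph_dist T u (p ! i)"
    using p(2) q assms(3) by (simp add: geodesic_def)
qed

lemma root_in_verts: "is_tree T \<Longrightarrow> root T \<in> verts T"
  by (simp add: is_tree_def simple_rooted_graph_def)

lemma level_0_eq_root:
  assumes "is_tree T" "w \<in> level T 0"
  shows "w = root T"
proof -
  obtain p where "geodesic T (root T) p w"
    using geodesic_exists[OF assms(1) root_in_verts] assms by (auto simp: level_def)
  then show ?thesis
    using assms by (auto simp: geodesic_def level_def walk_def length_Suc_conv)
qed

text \<open>Every vertex of level \<open>n + 1\<close> is a neighbour of one of level \<open>n\<close>. Neighbourhoods are finite because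
  their cardinality, the degree, is positive.\<close>
lemma finite_level:
  assumes "rooted_tree d T"
  shows "finite (level T n)"
proof (induction n)
  case 0
  have "level T 0 \<subseteq> {root T}"
    using assms level_0_eq_root by (auto simp: rooted_tree_def)
  then show ?case by (rule finite_subset) simp
next
  case (Suc n)
  have tree: "is_tree T" using assms by (simp add: rooted_tree_def)
  have "level T (Suc n) \<subseteq> (\<Union>u\<in>level T n. {w. adj T u w})"
  proof
    fix w assume w: "w \<in> level T (Suc n)"
    obtain p where p: "geodesic T (root T) p w"
      using geodesic_exists[OF tree root_in_verts[OF tree]] w by (auto simp: level_def)
    have len: "length p = Suc (Suc n)" using p w by (simp add: geodesic_def level_def)
    then have "p ! n \<in> level T n"
      using geodesic_nth_dist[OF tree p, of n] p
      by (auto simp: level_def geodesic_def walk_def)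
    moreover have "adj T (p ! n) (p ! Suc n)"
      using p len successively_nth[of "adj T" p n] by (simp add: geodesic_def walk_def)
    moreover have "p ! Suc n = w"
      using p len last_conv_nth[of p] unfolding geodesic_def walk_def by simp
    ultimately show "w \<in> (\<Union>u\<in>level T n. {w. adj T u w})" by auto
  qed
  moreover have "finite {w. adj T u w}" if "u \<in> level T n" for u
  proof -
    have "degree T u > 0"
    proof (cases n)
      case 0
      then have "u = root T" using level_0_eq_root[OF tree] that by simp
      moreover have "2 \<le> d 0" using assms by (simp add: rooted_tree_def)
      moreover have "degree T (root T) = d 0" using assms by (simp add: rooted_tree_def)
      ultimately show ?thesis by simp
    next
      case (Suc m)
      then show ?thesis using assms that by (simp add: rooted_tree_def level_def)
    qed
    then show ?thesis by (metis card.infinite degree_def less_irrefl)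
  qed
  ultimately show ?case using Suc.IH by (meson finite_UN finite_subset)
qed

text \<open>Geodesics from the root to \<open>a\<close> and to \<open>b\<close> stay within distance \<open>n\<close> of the root and so avoid \<open>w\<close>.
  They join to a path from \<open>a\<close> to \<open>b\<close> avoiding \<open>w\<close>; if \<open>a \<noteq> b\<close>, then \<open>w\<close> closes it to a cycle.\<close>
lemma parent_unique:
  assumes "is_tree T" "adj T a w" "adj T b w"
    and "graph_dist T (root T) a = n" "graph_dist T (root T) b = n"
    and "graph_dist T (root T) w = Suc n"
  shows "a = b"
proof (rule ccontr)
  assume "a \<noteq> b"
  have simple: "simple_rooted_graph T" using assms(1) by (simp add: is_tree_def)
  then have verts: "a \<in> verts T" "b \<in> verts T" "w \<in> verts T" "root T \<in> verts T"
      and "adj T w a"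
    using assms by (auto simp: simple_rooted_graph_def)
  obtain p q where p: "geodesic T (root T) p a" and q: "geodesic T (root T) q b"
    using geodesic_exists[OF assms(1)] verts by metis
  have avoids: "w \<notin> set r" if "geodesic T (root T) r x" "graph_dist T (root T) x = n" for r x
    using geodesic_nth_dist[OF assms(1) that(1)] that assms(6)
    by (metis geodesic_def in_set_conv_nth less_irrefl)
  have "walk T a (rev p @ tl q) b"
    using walk_append[OF walk_rev[OF simple]] p q unfolding geodesic_def by metis
  then obtain r where r: "walk T a r b" "distinct r" "set r \<subseteq> set (rev p @ tl q)"
    using walk_imp_distinct_walk by metis
  have "w \<notin> set r"
    using r(3) avoids[OF p] avoids[OF q] assms list.set_sel(2)[of q w] by (cases q) auto
  moreover have "length r \<ge> 2"
    using r(1) \<open>a \<noteq> b\<close> by (cases r rule: remdups_adj.cases) (auto simp: walk_def)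
  moreover have "walk T w (w # r) b"
    using r(1) \<open>adj T w a\<close> verts by (auto simp: walk_def successively_Cons)
  ultimately have "walk T w (w # r) b \<and> distinct (w # r) \<and> length (w # r) \<ge> 3 \<and> adj T b w"
    using r(2) assms(3) by simp
  then have "\<exists>x s y. walk T x s y \<and> distinct s \<and> length s \<ge> 3 \<and> adj T y x"
    by (intro exI)
  then show False using assms(1) by (simp add: is_tree_def)
qed

section \<open>Group actions on trees\<close>

locale tree_group_action = group_action G "verts T" \<phi>
  for G :: "('g, 'm) monoid_scheme" (structure) and T :: "'v rooted_graph" and \<phi> +
  assumes tree: "is_tree T"
    and fixes_root: "g \<in> carrier G \<Longrightarrow> \<phi> g (root T) = root T"
    and adj_image_iff: "\<lbrakk>g \<in> carrier G; u \<in> verts T; w \<in> verts T\<rbrakk>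
      \<Longrightarrow> adj T (\<phi> g u) (\<phi> g w) \<longleftrightarrow> adj T u w"
begin

sublocale group G
  using group_hom group_hom.axioms(1) by auto

lemma image_closed: "g \<in> carrier G \<Longrightarrow> w \<in> verts T \<Longrightarrow> \<phi> g w \<in> verts T"
  using element_image by blast

lemma image_inv_image [simp]:
  assumes "g \<in> carrier G" "w \<in> verts T"
  shows "\<phi> (inv g) (\<phi> g w) = w" and "\<phi> g (\<phi> (inv g) w) = w"
  using assms orbit_sym_aux[OF assms refl] orbit_sym_aux[OF inv_closed[OF assms(1)] assms(2) refl]
  by simp_all

lemma walk_image:
  assumes "g \<in> carrier G" "walk T u p w"
  shows "walk T (\<phi> g u) (map (\<phi> g) p) (\<phi> g w)"
proof -
  have "successively (\<lambda>x y. adj T (\<phi> g x) (\<phi> g y)) p"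
  proof (rule successively_mono)
    show "successively (adj T) p" using assms by (simp add: walk_def)
  qed (use assms in \<open>auto simp: walk_def adj_image_iff subset_iff\<close>)
  then show ?thesis
    using assms image_closed[OF assms(1)]
    by (auto simp: walk_def successively_map hd_map last_map)
qed

text \<open>Automorphisms carry walks to walks, so they do not increase the distance to the root; neither do
  their inverses.\<close>
lemma root_dist_image:
  assumes "g \<in> carrier G" "w \<in> verts T"
  shows "graph_dist T (root T) (\<phi> g w) = graph_dist T (root T) w"
proof -
  have le: "graph_dist T (root T) (\<phi> h u) \<le> graph_dist T (root T) u"
    if h: "h \<in> carrier G" and u: "u \<in> verts T" for h u
  proof -
    obtain p where p: "geodesic T (root T) p u"
      using geodesic_exists[OF tree root_in_verts[OF tree] u] .
    then have "walk T (root T) (map (\<phi> h) p) (\<phi> h u)"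
      using walk_image[OF h] fixes_root[OF h] unfolding geodesic_def by metis
    from graph_dist_le[OF this] show ?thesis using p by (simp add: geodesic_def)
  qed
  show ?thesis
    using le[OF assms] le[of "inv g" "\<phi> g w"] assms image_closed by (simp add: le_antisym)
qed

lemma level_image: "g \<in> carrier G \<Longrightarrow> w \<in> level T n \<Longrightarrow> \<phi> g w \<in> level T n"
  by (simp add: level_def root_dist_image image_closed)

lemma descendants_image:
  assumes "g \<in> carrier G" "w \<in> descendants T v"
  shows "\<phi> g w \<in> descendants T (\<phi> g v)"
proof -
  obtain p where p: "geodesic T (root T) p w" "v \<in> set p" and w: "w \<in> verts T"
    using assms by (auto simp: descendants_def)
  then have "geodesic T (root T) (map (\<phi> g) p) (\<phi> g w)"
    using walk_image[OF assms(1)] fixes_root[OF assms(1)] root_dist_image[OF assms(1) w]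
    unfolding geodesic_def by (metis length_map)
  then show ?thesis
    using p w assms image_closed by (auto simp: descendants_def)
qed

lemma descendant_of_level:
  assumes "w \<in> verts T" "n \<le> graph_dist T (root T) w"
  shows "\<exists>u\<in>level T n. w \<in> descendants T u"
proof -
  obtain p where p: "geodesic T (root T) p w"
    using geodesic_exists[OF tree root_in_verts[OF tree] assms(1)] .
  then have n: "n < length p" using assms by (simp add: geodesic_def)
  then have "p ! n \<in> level T n"
    using p geodesic_nth_dist[OF tree p] by (auto simp: level_def geodesic_def walk_def)
  then show ?thesis
    using p nth_mem[OF n] assms unfolding descendants_def by blast
qed

text \<open>Downward induction on \<open>m\<close>: every vertex of level \<open>m < n\<close> has a child, which \<open>k\<close> fixes by induction,
  and \<open>k\<close> maps the parent of a fixed vertex to a parent of the same vertex.\<close>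
lemma fixes_ancestors_of_level:
  assumes trans: "spherically_transitive G T \<phi>" and v: "v \<in> level T n"
    and k: "k \<in> carrier G" "\<And>w. w \<in> level T n \<Longrightarrow> \<phi> k w = w"
    and "m \<le> n" "u \<in> level T m"
  shows "\<phi> k u = u"
  using assms(5,6)
proof (induction m arbitrary: u rule: inc_induct)
  case base
  then show ?case using k by simp
next
  case (step m)
  obtain p where p: "geodesic T (root T) p v"
    using geodesic_exists[OF tree root_in_verts[OF tree]] v by (auto simp: level_def)
  then have len: "length p = Suc n" using v by (simp add: geodesic_def level_def)
  have lev: "p ! i \<in> level T i" if "i \<le> n" for i
    using p len that geodesic_nth_dist[OF tree p]
    by (auto simp: level_def geodesic_def walk_def)
  \<comment> \<open>Carrying the path to \<open>v\<close> along by transitivity produces a child of \<open>u\<close>.\<close>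
  obtain g where g: "g \<in> carrier G" "\<phi> g (p ! m) = u"
    using trans lev[OF less_imp_le[OF step(2)]] step(4)
    unfolding spherically_transitive_def by blast
  define w where "w = \<phi> g (p ! Suc m)"
  have w: "w \<in> level T (Suc m)"
    unfolding w_def using level_image[OF g(1) lev] step by simp
  have "adj T (p ! m) (p ! Suc m)"
    using p len step successively_nth[of "adj T" p m] by (simp add: geodesic_def walk_def)
  then have "adj T u w"
    unfolding w_def using adj_image_iff[OF g(1)] g(2) lev[of m] lev[of "Suc m"] step
    by (auto simp: level_def)
  moreover have "adj T (\<phi> k u) w"
    using adj_image_iff[OF k(1), of u w] step w calculation by (auto simp: level_def)
  moreover have "\<phi> k u \<in> level T m" using level_image[OF k(1)] step by blast
  ultimately show ?case
    using parent_unique[OF tree, of "\<phi> k u" w u m] w step by (simp add: level_def)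
qed

lemma subtree_stabilizer_conj:
  assumes g: "g \<in> carrier G" and v: "v \<in> verts T" and x: "x \<in> subtree_stabilizer G T \<phi> v"
  shows "g \<otimes> x \<otimes> inv g \<in> subtree_stabilizer G T \<phi> (\<phi> g v)"
proof -
  have xG: "x \<in> carrier G" using x by (simp add: subtree_stabilizer_def)
  have "\<phi> (g \<otimes> x \<otimes> inv g) w = w" if w: "w \<in> descendants T (\<phi> g v)" for w
  proof -
    have wv: "w \<in> verts T" using w by (simp add: descendants_def)
    have "\<phi> (inv g) w \<in> descendants T v"
      using descendants_image[of "inv g", OF _ w] g v by simp
    then have "\<phi> x (\<phi> (inv g) w) = \<phi> (inv g) w"
      using x by (simp add: subtree_stabilizer_def)
    then show ?thesis
      using g xG wv by (simp add: composition_rule image_closed)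
  qed
  then show ?thesis using g xG by (simp add: subtree_stabilizer_def)
qed

lemma pointwise_stabilizer_subgroup:
  assumes "D \<subseteq> verts T"
  shows "subgroup {g \<in> carrier G. \<forall>w\<in>D. \<phi> g w = w} G"
proof (rule subgroupI)
  show "{g \<in> carrier G. \<forall>w\<in>D. \<phi> g w = w} \<noteq> {}"
    using assms stabilizer_one_closed by (auto simp: stabilizer_def)
  show "inv g \<in> {g \<in> carrier G. \<forall>w\<in>D. \<phi> g w = w}"
    if "g \<in> {g \<in> carrier G. \<forall>w\<in>D. \<phi> g w = w}" for g
    using that assms orbit_sym_aux[of g] by blast
qed (use assms in \<open>auto simp: composition_rule subset_iff\<close>)

lemma subtree_stabilizer_subgroup: "subgroup (subtree_stabilizer G T \<phi> v) G"
  unfolding subtree_stabilizer_def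
  by (rule pointwise_stabilizer_subgroup) (auto simp: descendants_def)

lemma stabilizer_le_normalizer:
  assumes v: "v \<in> verts T"
  shows "stabilizer G \<phi> v \<subseteq> normalizer G (subtree_stabilizer G T \<phi> v)"
proof
  fix g assume "g \<in> stabilizer G \<phi> v"
  then have g: "g \<in> carrier G" "\<phi> g v = v" by (auto simp: stabilizer_def)
  let ?S = "subtree_stabilizer G T \<phi> v"
  have S: "?S \<subseteq> carrier G" by (auto simp: subtree_stabilizer_def)
  have "g <# ?S #> inv g = ?S"
  proof
    show "g <# ?S #> inv g \<subseteq> ?S"
      using subtree_stabilizer_conj[OF g(1) v] g(2) by (auto simp: l_coset_def r_coset_def)
    show "?S \<subseteq> g <# ?S #> inv g"
    proof
      fix x assume x: "x \<in> ?S"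
      have "\<phi> (inv g) v = v" using orbit_sym_aux[OF g(1) v g(2)] .
      then have "inv g \<otimes> x \<otimes> g \<in> ?S"
        using subtree_stabilizer_conj[of "inv g", OF _ v x] g by simp
      moreover have "x = g \<otimes> (inv g \<otimes> x \<otimes> g) \<otimes> inv g"
        using g x S by (simp add: m_assoc subset_iff) (simp flip: m_assoc)
      ultimately show "x \<in> g <# ?S #> inv g"
        unfolding l_coset_def r_coset_def by blast
    qed
  qed
  then show "g \<in> normalizer G ?S"
    using g S by (simp add: normalizer_def stabilizer_def)
qed

end

text \<open>The right coset of \<open>g\<close> depends only on the point to which the inverse of \<open>g\<close> moves \<open>x\<close>; so there are
  at most as many cosets as points in the orbit.\<close>
lemma (in group_action) finite_rcosets_of_finite_orbit:
  assumes "x \<in> E" "finite (orbit G \<phi> x)" "subgroup K G" "stabilizer G \<phi> x \<subseteq> K"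
  shows "finite (rcosets K)"
proof -
  interpret group G using group_hom group_hom.axioms(1) by auto
  define rep where "rep y = (SOME g. g \<in> carrier G \<and> \<phi> (inv g) x = y)" for y
  have "rcosets K \<subseteq> (\<lambda>y. K #> rep y) ` orbit G \<phi> x"
  proof
    fix R assume "R \<in> rcosets K"
    then obtain g where g: "g \<in> carrier G" "R = K #> g" by (auto simp: RCOSETS_def)
    define h where "h = rep (\<phi> (inv g) x)"
    have h: "h \<in> carrier G" "\<phi> (inv h) x = \<phi> (inv g) x"
      using someI_ex[of "\<lambda>h. h \<in> carrier G \<and> \<phi> (inv h) x = \<phi> (inv g) x"] g(1)
      by (auto simp: h_def rep_def)
    have "\<phi> (h \<otimes> inv g) x = \<phi> h (\<phi> (inv h) x)"
      using g h assms(1) by (simp add: composition_rule)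
    also have "\<dots> = x" using h assms(1) orbit_sym_aux[of "inv h" x] by simp
    finally have "h \<otimes> inv g \<in> K"
      using assms(4) g h by (auto simp: stabilizer_def)
    then have "(h \<otimes> inv g) \<otimes> g \<in> K #> g" by (auto simp: r_coset_def)
    then have "h \<in> K #> g" using g h by (simp add: m_assoc)
    then have "R = K #> h" using repr_independence g assms(3) by metis
    then show "R \<in> (\<lambda>y. K #> rep y) ` orbit G \<phi> x"
      using g by (auto simp: h_def orbit_def)
  qed
  then show ?thesis using assms(2) finite_surj by blast
qed

text \<open>There are only finitely many maps from \<open>F\<close> to itself, so infinitely many elements of \<open>S\<close> act alike
  on \<open>F\<close>, and their quotients fix \<open>F\<close> pointwise.\<close>
lemma (in group_action) infinite_Int_pointwise_stabilizer:
  assumes "subgroup S G" "infinite S" "finite F" "F \<subseteq> E" "\<And>g w. g \<in> carrier G \<Longrightarrow> w \<in> F \<Longrightarrow> \<phi> g w \<in> F"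
  shows "infinite (S \<inter> {g \<in> carrier G. \<forall>w\<in>F. \<phi> g w = w})"
proof -
  interpret group G using group_hom group_hom.axioms(1) by auto
  have S: "S \<subseteq> carrier G" using assms(1) by (rule subgroup.subset)
  have "(\<lambda>g. restrict (\<phi> g) F) ` S \<subseteq> F \<rightarrow>\<^sub>E F" using assms(5) S by auto
  then have "finite ((\<lambda>g. restrict (\<phi> g) F) ` S)"
    by (rule finite_subset) (simp add: assms(3) finite_PiE)
  then obtain r where r: "r \<in> (\<lambda>g. restrict (\<phi> g) F) ` S"
      "infinite ((\<lambda>g. restrict (\<phi> g) F) -` {r} \<inter> S)" (is "infinite ?A")
    using assms(2) by (rule inf_img_fin_domE')
  then obtain h where h: "h \<in> S" "r = restrict (\<phi> h) F" by auto
  have "inj_on (\<lambda>g. inv h \<otimes> g) ?A"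
    using h S by (auto simp: inj_on_def subset_iff)
  then have "infinite ((\<lambda>g. inv h \<otimes> g) ` ?A)" using r(2) finite_imageD by blast
  moreover have "(\<lambda>g. inv h \<otimes> g) ` ?A \<subseteq> S \<inter> {g \<in> carrier G. \<forall>w\<in>F. \<phi> g w = w}"
  proof
    fix k assume "k \<in> (\<lambda>g. inv h \<otimes> g) ` ?A"
    then obtain g where g: "g \<in> S" "restrict (\<phi> g) F = restrict (\<phi> h) F" "k = inv h \<otimes> g"
      using h by auto
    have gh: "g \<in> carrier G" "h \<in> carrier G" using g h S by auto
    have "\<phi> k w = w" if w: "w \<in> F" for w
    proof -
      have "\<phi> g w = \<phi> h w" using g(2) w by (metis restrict_apply')
      then show ?thesis
        using gh w assms(4) g(3) orbit_sym_aux[of h w] by (auto simp: composition_rule)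
    qed
    moreover have "k \<in> S"
      using g h assms(1) by (simp add: subgroup.m_closed subgroup.m_inv_closed)
    ultimately show "k \<in> S \<inter> {g \<in> carrier G. \<forall>w\<in>F. \<phi> g w = w}" using S by auto
  qed
  ultimately show ?thesis using finite_subset by blast
qed

section \<open>Elements of the group algebra that annihilate points\<close>

text \<open>The linear extension of \<open>f\<close> to the group algebra, applied to \<open>a\<close>. The coefficients of \<open>a\<close>, the
  values of its operators and its matrix coefficients are all of this form.\<close>
definition pairing :: "('g \<Rightarrow>\<^sub>0 complex) \<Rightarrow> ('g \<Rightarrow> complex) \<Rightarrow> complex" where
  "pairing a f = (\<Sum>g\<in>Poly_Mapping.keys a. Poly_Mapping.lookup a g * f g)"

lemma pairing_superset:
  assumes "finite A" "Poly_Mapping.keys a \<subseteq> A"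
  shows "pairing a f = (\<Sum>g\<in>A. Poly_Mapping.lookup a g * f g)"
  unfolding pairing_def using assms
  by (intro sum.mono_neutral_left) (auto simp: in_keys_iff)

lemma pairing_diff: "pairing (a - b) f = pairing a f - pairing b f"
proof -
  let ?A = "Poly_Mapping.keys a \<union> Poly_Mapping.keys b"
  have "pairing (a - b) f = (\<Sum>g\<in>?A. Poly_Mapping.lookup (a - b) g * f g)"
    using keys_diff[of a b] by (intro pairing_superset) simp_all
  also have "\<dots> = pairing a f - pairing b f"
    by (simp add: pairing_superset[of ?A] lookup_minus left_diff_distrib sum_subtractf)
  finally show ?thesis .
qed

lemma pairing_single [simp]: "pairing (Poly_Mapping.single g c) f = c * f g"
  by (simp add: pairing_def)

lemma pairing_add: "pairing (a + b) f = pairing a f + pairing b f"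
  using pairing_diff[of "a + b" b f] by simp

lemma pairing_sum: "pairing (\<Sum>i\<in>I. a i) f = (\<Sum>i\<in>I. pairing (a i) f)"
  by (induction I rule: infinite_finite_induct) (simp_all add: pairing_add pairing_def[of 0])

lemma lookup_eq_pairing: "Poly_Mapping.lookup a g = pairing a (\<lambda>h. if h = g then 1 else 0)"
  by (cases "g \<in> Poly_Mapping.keys a") (auto simp: pairing_def in_keys_iff if_distrib cong: if_cong)

text \<open>The product \<open>a (1 - x)\<close> in the group algebra.\<close>
definition times_one_minus ::
    "('g, 'm) monoid_scheme \<Rightarrow> ('g \<Rightarrow>\<^sub>0 complex) \<Rightarrow> 'g \<Rightarrow> ('g \<Rightarrow>\<^sub>0 complex)" where
  "times_one_minus G a x =
     a - (\<Sum>g\<in>Poly_Mapping.keys a. Poly_Mapping.single (g \<otimes>\<^bsub>G\<^esub> x) (Poly_Mapping.lookup a g))"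

lemma pairing_times_one_minus:
  "pairing (times_one_minus G a x) f = pairing a f - pairing a (\<lambda>g. f (g \<otimes>\<^bsub>G\<^esub> x))"
  by (simp add: times_one_minus_def pairing_diff pairing_sum pairing_def[of _ "\<lambda>g. f (g \<otimes>\<^bsub>G\<^esub> x)"])

lemma keys_times_one_minus:
  "Poly_Mapping.keys (times_one_minus G a x)
    \<subseteq> Poly_Mapping.keys a \<union> (\<lambda>g. g \<otimes>\<^bsub>G\<^esub> x) ` Poly_Mapping.keys a"
proof -
  have "Poly_Mapping.keys (\<Sum>g\<in>Poly_Mapping.keys a.
      Poly_Mapping.single (g \<otimes>\<^bsub>G\<^esub> x) (Poly_Mapping.lookup a g))
    \<subseteq> (\<lambda>g. g \<otimes>\<^bsub>G\<^esub> x) ` Poly_Mapping.keys a"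
    by (rule order_trans[OF keys_sum]) auto
  then show ?thesis
    unfolding times_one_minus_def by (intro order_trans[OF keys_diff] Un_mono order_refl)
qed

lemma (in group) lookup_one_times_one_minus:
  assumes "Poly_Mapping.keys a \<subseteq> carrier G" "x \<in> carrier G" "inv x \<notin> Poly_Mapping.keys a"
  shows "Poly_Mapping.lookup (times_one_minus G a x) \<one> = Poly_Mapping.lookup a \<one>"
proof -
  have "g \<otimes> x \<noteq> \<one>" if "g \<in> Poly_Mapping.keys a" for g
    using assms that inv_equality[of g x] by auto
  then have "pairing a (\<lambda>g. if g \<otimes> x = \<one> then 1 else 0) = 0"
    unfolding pairing_def by (intro sum.neutral) auto
  then show ?thesis by (simp add: lookup_eq_pairing pairing_times_one_minus)
qed

text \<open>All functions \<open>\<xi>\<close> are admitted, not only the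
  square-summable ones, so that \<open>\<xi>\<close> may be replaced freely by its translates.\<close>
definition annihilates ::
    "('g, 'm) monoid_scheme \<Rightarrow> ('g \<Rightarrow> 'v \<Rightarrow> 'v) \<Rightarrow> ('g \<Rightarrow>\<^sub>0 complex) \<Rightarrow> 'v \<Rightarrow> bool" where
  "annihilates G \<phi> a w \<longleftrightarrow> (\<forall>\<xi>. pairing a (\<lambda>g. \<xi> (\<phi> (inv\<^bsub>G\<^esub> g) w)) = 0)"

text \<open>At \<open>w\<close>, the operator of \<open>a (1 - x)\<close> takes the value of \<open>a\<close> applied to \<open>\<xi>\<close> minus that of \<open>a\<close> applied to
  the translate of \<open>\<xi>\<close> by \<open>x\<close>. Both vanish if \<open>a\<close> annihilates \<open>w\<close>. They agree if \<open>x\<close> fixes all points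
  at which \<open>a\<close> reads \<open>\<xi>\<close>.\<close>
lemma (in group_action) annihilates_times_one_minus:
  assumes "Poly_Mapping.keys a \<subseteq> carrier G" "x \<in> carrier G" "w \<in> E"
    and "annihilates G \<phi> a w \<or>
      (\<forall>g\<in>Poly_Mapping.keys a. \<phi> x (\<phi> (inv g) w) = \<phi> (inv g) w)"
  shows "annihilates G \<phi> (times_one_minus G a x) w"
  unfolding annihilates_def pairing_times_one_minus
proof
  fix \<xi> :: "'c \<Rightarrow> complex"
  interpret group G using group_hom group_hom.axioms(1) by auto
  have eq: "pairing a (\<lambda>g. \<xi> (\<phi> (inv (g \<otimes> x)) w)) = pairing a (\<lambda>g. \<xi> (\<phi> (inv x) (\<phi> (inv g) w)))"
    unfolding pairing_def using assms(1,2,3)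
    by (intro sum.cong) (auto simp: inv_mult_group composition_rule subset_iff)
  show "pairing a (\<lambda>g. \<xi> (\<phi> (inv g) w)) - pairing a (\<lambda>g. \<xi> (\<phi> (inv (g \<otimes> x)) w)) = 0"
    using assms(4)
  proof
    assume ann: "annihilates G \<phi> a w"
    then have "pairing a (\<lambda>g. \<xi> (\<phi> (inv g) w)) = 0" by (simp add: annihilates_def)
    moreover have "pairing a (\<lambda>g. (\<xi> \<circ> \<phi> (inv x)) (\<phi> (inv g) w)) = 0"
      using ann unfolding annihilates_def by blast
    ultimately show ?thesis by (simp add: eq)
  next
    assume fixed: "\<forall>g\<in>Poly_Mapping.keys a. \<phi> x (\<phi> (inv g) w) = \<phi> (inv g) w"
    have "\<phi> (inv x) (\<phi> (inv g) w) = \<phi> (inv g) w" if "g \<in> Poly_Mapping.keys a" for g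
    proof (rule orbit_sym_aux[OF assms(2)])
      show "\<phi> (inv g) w \<in> E"
        using element_image[OF _ assms(3) refl, of "inv g"] that assms(1) by auto
    qed (use that fixed in blast)
    then show ?thesis unfolding eq by (simp add: pairing_def)
  qed
qed

text \<open>The annihilator is a product of factors \<open>1 - x\<close> with one \<open>x \<in> S i\<close> for each \<open>i\<close>. Since all factors lie
  in the group algebra of \<open>N\<close>, which preserves each \<open>D i\<close>, the factor for \<open>i\<close> makes the whole product
  annihilate \<open>D i\<close>. As \<open>S i\<close> is infinite, \<open>x\<close> can be chosen with its inverse outside the support of
  the product so far, so that the coefficient at the identity remains 1.\<close>
lemma (in group_action) exists_annihilator:
  assumes "finite I" "subgroup N G"
    and "\<forall>i\<in>I. infinite (S i) \<and> S i \<subseteq> N \<and> D i \<subseteq> E \<and>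
      (\<forall>g\<in>N. \<forall>w\<in>D i. \<phi> g w \<in> D i) \<and> (\<forall>x\<in>S i. \<forall>w\<in>D i. \<phi> x w = w)"
  shows "\<exists>a. Poly_Mapping.keys a \<subseteq> N \<and> Poly_Mapping.lookup a \<one> = 1 \<and>
    (\<forall>i\<in>I. \<forall>w\<in>D i. annihilates G \<phi> a w)"
  using assms(1,3)
proof (induction I rule: finite_induct)
  case empty
  show ?case
  proof (intro exI conjI)
    show "Poly_Mapping.keys (Poly_Mapping.single \<one> (1 :: complex)) \<subseteq> N"
      using subgroup.one_closed[OF assms(2)] by (simp only: keys_single) simp
    show "Poly_Mapping.lookup (Poly_Mapping.single \<one> 1) \<one> = 1"
      by (rule lookup_single_eq)
  qed simp
next
  case (insert i I)
  interpret group G using group_hom group_hom.axioms(1) by auto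
  obtain a where a: "Poly_Mapping.keys a \<subseteq> N" "Poly_Mapping.lookup a \<one> = 1"
      "\<forall>i\<in>I. \<forall>w\<in>D i. annihilates G \<phi> a w"
    using insert.IH insert.prems by auto
  have N: "N \<subseteq> carrier G" using assms(2) by (rule subgroup.subset)
  have S: "infinite (S i)" "S i \<subseteq> N" using insert.prems by auto
  have D: "\<And>g w. g \<in> N \<Longrightarrow> w \<in> D i \<Longrightarrow> \<phi> g w \<in> D i" "\<And>x w. x \<in> S i \<Longrightarrow> w \<in> D i \<Longrightarrow> \<phi> x w = w"
    using insert.prems by auto
  have "S i \<inter> {x. inv x \<in> Poly_Mapping.keys a} \<subseteq> (\<lambda>g. inv g) ` Poly_Mapping.keys a"
    using S N by (force simp: subset_iff image_iff)
  then have "finite (S i \<inter> {x. inv x \<in> Poly_Mapping.keys a})"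
    by (rule finite_subset) simp
  then have "\<not> S i \<subseteq> {x. inv x \<in> Poly_Mapping.keys a}"
    using S(1) by (auto simp: Int_absorb2)
  then obtain x where x: "x \<in> S i" "inv x \<notin> Poly_Mapping.keys a" by blast
  have xN: "x \<in> N" "x \<in> carrier G" and aG: "Poly_Mapping.keys a \<subseteq> carrier G"
    using x S N a by auto
  have "annihilates G \<phi> (times_one_minus G a x) w" if "j \<in> insert i I" "w \<in> D j" for j w
  proof (rule annihilates_times_one_minus[OF aG xN(2)])
    show "w \<in> E" using that insert.prems by blast
    show "annihilates G \<phi> a w \<or> (\<forall>g\<in>Poly_Mapping.keys a. \<phi> x (\<phi> (inv g) w) = \<phi> (inv g) w)"
    proof (cases "j \<in> I")
      case True
      then show ?thesis using a that by blast
    next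
      case False
      have "\<phi> x (\<phi> (inv g) w) = \<phi> (inv g) w" if g: "g \<in> Poly_Mapping.keys a" for g
      proof -
        have "inv g \<in> N" using g a assms(2) by (auto intro: subgroup.m_inv_closed)
        then have "\<phi> (inv g) w \<in> D i" using D(1) \<open>w \<in> D j\<close> \<open>j \<in> insert i I\<close> False by blast
        then show ?thesis using D(2) x by blast
      qed
      then show ?thesis by blast
    qed
  qed
  moreover have "Poly_Mapping.keys (times_one_minus G a x) \<subseteq> N"
    using keys_times_one_minus[of G a x] a(1) xN(1) subgroup.m_closed[OF assms(2)] by blast
  moreover have "Poly_Mapping.lookup (times_one_minus G a x) \<one> = 1"
    using lookup_one_times_one_minus[OF aG xN(2) x(2)] a(2) by simp
  ultimately show ?case by blast
qed

section \<open>Consequences of annihilation for unitary representations\<close>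

lemma summable_ell2_product:
  assumes "\<xi> \<in> ell2 X" "\<eta> \<in> ell2 X"
  shows "(\<lambda>x. \<xi> x * cnj (\<eta> x)) summable_on UNIV"
proof -
  have "(\<lambda>x. (cmod (\<xi> x))\<^sup>2 + (cmod (\<eta> x))\<^sup>2) summable_on X"
    using assms by (intro summable_on_add) (auto simp: ell2_def)
  moreover have "norm (\<xi> x * cnj (\<eta> x)) \<le> (cmod (\<xi> x))\<^sup>2 + (cmod (\<eta> x))\<^sup>2" for x
  proof -
    have "2 * (cmod (\<xi> x) * cmod (\<eta> x)) \<le> (cmod (\<xi> x))\<^sup>2 + (cmod (\<eta> x))\<^sup>2"
      using sum_squares_bound[of "cmod (\<xi> x)" "cmod (\<eta> x)"] by simp
    then show ?thesis
      using mult_nonneg_nonneg[OF norm_ge_zero norm_ge_zero, of "\<xi> x" "\<eta> x"]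
      unfolding norm_mult complex_mod_cnj by linarith
  qed
  ultimately have "(\<lambda>x. norm (\<xi> x * cnj (\<eta> x))) summable_on X"
    by (rule abs_summable_on_comparison_test')
  then have "(\<lambda>x. \<xi> x * cnj (\<eta> x)) summable_on X"
    by (rule abs_summable_summable)
  then show ?thesis
    using assms by (subst summable_on_cong_neutral[of X]) (auto simp: ell2_def)
qed

lemma ell2_inner_linear_combination:
  assumes "finite K" "\<eta> \<in> ell2 X" "\<And>g. g \<in> K \<Longrightarrow> \<xi> g \<in> ell2 X"
  shows "(\<Sum>g\<in>K. c g * ell2_inner (\<xi> g) \<eta>) = ell2_inner (\<lambda>x. \<Sum>g\<in>K. c g * \<xi> g x) \<eta>"
proof -
  have "((\<lambda>x. \<Sum>g\<in>K. c g * (\<xi> g x * cnj (\<eta> x))) has_sum (\<Sum>g\<in>K. c g * ell2_inner (\<xi> g) \<eta>)) UNIV"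
    using assms(1,3)
  proof (induction K rule: finite_induct)
    case (insert g K)
    have "((\<lambda>x. \<xi> g x * cnj (\<eta> x)) has_sum ell2_inner (\<xi> g) \<eta>) UNIV"
      unfolding ell2_inner_def
      by (rule has_sum_infsum) (use insert.prems assms(2) summable_ell2_product in blast)
    then show ?case
      using insert by (simp add: has_sum_add has_sum_cmult_right)
  qed simp
  then show ?thesis
    unfolding ell2_inner_def by (simp add: infsumI sum_distrib_right mult.assoc)
qed

text \<open>Pairing \<open>a\<close> with the matrix coefficient of the regular representation at the point mass \<open>\<delta>\<close> of the
  identity gives \<open>a(1)\<close>; pairing it with any coefficient of \<open>\<pi>\<close> gives 0. Approximation up to \<open>\<epsilon>\<close> on
  the support of \<open>a\<close> changes the pairing by at most \<open>\<epsilon>\<close> times the sum of the absolute values of the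
  coefficients of \<open>a\<close>, so that \<open>a(1)\<close> would have to be arbitrarily small.\<close>
lemma (in group) not_weakly_contained_of_annihilator:
  assumes keys: "Poly_Mapping.keys a \<subseteq> carrier G" and one: "Poly_Mapping.lookup a \<one> \<noteq> 0"
    and closed: "\<And>g \<nu>. \<lbrakk>g \<in> carrier G; \<nu> \<in> ell2 X\<rbrakk> \<Longrightarrow> \<pi> g \<nu> \<in> ell2 X"
    and ann: "\<And>\<nu> x. \<nu> \<in> ell2 X \<Longrightarrow> pairing a (\<lambda>g. \<pi> g \<nu> x) = 0"
  shows "\<not> weakly_contained G (ell2 (carrier G)) ell2_inner (regular_rep G) (ell2 X) ell2_inner \<pi>"
proof
  assume wc: "weakly_contained G (ell2 (carrier G)) ell2_inner (regular_rep G) (ell2 X) ell2_inner \<pi>"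
  define \<delta> :: "'a \<Rightarrow> complex" where "\<delta> = (\<lambda>h. if h = \<one> then 1 else 0)"
  define A where "A = (\<Sum>g\<in>Poly_Mapping.keys a. cmod (Poly_Mapping.lookup a g))"
  \<comment> \<open>The summand 1 keeps the denominator positive and makes the final estimate strict.\<close>
  define \<epsilon> where "\<epsilon> = cmod (Poly_Mapping.lookup a \<one>) / (1 + A)"
  have "A \<ge> 0" unfolding A_def by (rule sum_nonneg) simp
  then have "\<epsilon> > 0" using one by (simp add: \<epsilon>_def)
  have "((\<lambda>x. (cmod (\<delta> x))\<^sup>2) has_sum 1) (carrier G)"
    by (rule has_sum_finite_neutralI[of "{\<one>}"]) (auto simp: \<delta>_def)
  then have "\<delta> \<in> ell2 (carrier G)"
    by (auto simp: ell2_def \<delta>_def summable_on_def)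
  then obtain \<nu>s where \<nu>s: "set \<nu>s \<subseteq> ell2 X"
      and close: "\<And>g. g \<in> Poly_Mapping.keys a \<Longrightarrow>
        cmod (ell2_inner (regular_rep G g \<delta>) \<delta> - (\<Sum>\<nu>\<leftarrow>\<nu>s. ell2_inner (\<pi> g \<nu>) \<nu>)) < \<epsilon>"
    using wc \<open>\<epsilon> > 0\<close> keys finite_keys[of a] unfolding weakly_contained_def by meson
  have regular: "ell2_inner (regular_rep G g \<delta>) \<delta> = (if g = \<one> then 1 else 0)"
    if "g \<in> carrier G" for g
  proof -
    have "((\<lambda>x. regular_rep G g \<delta> x * cnj (\<delta> x)) has_sum (if g = \<one> then 1 else 0)) UNIV"
      by (rule has_sum_finite_neutralI[of "{\<one>}"])
        (use that in \<open>auto simp: \<delta>_def regular_rep_def inv_eq_1_iff\<close>)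
    then show ?thesis unfolding ell2_inner_def by (rule infsumI)
  qed
  have "pairing a (\<lambda>g. ell2_inner (\<pi> g \<nu>) \<nu>) = 0" if "\<nu> \<in> ell2 X" for \<nu>
  proof -
    have "pairing a (\<lambda>g. ell2_inner (\<pi> g \<nu>) \<nu>) = ell2_inner (\<lambda>x. pairing a (\<lambda>g. \<pi> g \<nu> x)) \<nu>"
      unfolding pairing_def
      by (rule ell2_inner_linear_combination) (use that closed keys in auto)
    then show ?thesis using ann[OF that] by (simp add: ell2_inner_def)
  qed
  then have "pairing a (\<lambda>g. \<Sum>\<nu>\<leftarrow>\<nu>s. ell2_inner (\<pi> g \<nu>) \<nu>) = 0"
    using \<nu>s by (induction \<nu>s) (simp_all add: pairing_def distrib_left sum.distrib)
  moreover have "pairing a (\<lambda>g. ell2_inner (regular_rep G g \<delta>) \<delta>) = Poly_Mapping.lookup a \<one>"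
    unfolding lookup_eq_pairing[of a \<one>] pairing_def
    using keys regular by (intro sum.cong) auto
  ultimately have "Poly_Mapping.lookup a \<one> = pairing a (\<lambda>g.
      ell2_inner (regular_rep G g \<delta>) \<delta> - (\<Sum>\<nu>\<leftarrow>\<nu>s. ell2_inner (\<pi> g \<nu>) \<nu>))"
    by (simp add: pairing_def right_diff_distrib sum_subtractf)
  also have "cmod \<dots> \<le> A * \<epsilon>"
    unfolding pairing_def A_def sum_distrib_right
    using close by (intro sum_norm_le) (auto simp: norm_mult intro!: mult_left_mono dest: less_imp_le)
  also have "\<dots> < (1 + A) * \<epsilon>" using \<open>\<epsilon> > 0\<close> by simp
  also have "\<dots> = cmod (Poly_Mapping.lookup a \<one>)" using \<open>A \<ge> 0\<close> by (simp add: \<epsilon>_def)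
  finally show False by simp
qed

context tree_group_action
begin

lemma tree_rep_in_ell2:
  assumes "g \<in> carrier G" "\<nu> \<in> ell2 (verts T)"
  shows "tree_rep G T \<phi> g \<nu> \<in> ell2 (verts T)"
proof -
  have "bij_betw (\<phi> (inv g)) (verts T) (verts T)"
    using bij_prop0[of "inv g"] assms by (simp add: Bij_def)
  from summable_on_reindex_bij_betw[OF this, of "\<lambda>x. (cmod (\<nu> x))\<^sup>2"]
  have "(\<lambda>x. (cmod (\<nu> (\<phi> (inv g) x)))\<^sup>2) summable_on verts T"
    using assms by (simp add: ell2_def)
  then have "(\<lambda>x. (cmod (tree_rep G T \<phi> g \<nu> x))\<^sup>2) summable_on verts T"
    by (rule summable_on_cong[THEN iffD1, rotated]) (simp add: tree_rep_def)
  then show ?thesis by (simp add: ell2_def tree_rep_def)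
qed

lemma annihilates_imp_tree_rep_zero:
  assumes "\<And>w. w \<in> verts T \<Longrightarrow> annihilates G \<phi> a w"
  shows "pairing a (\<lambda>g. tree_rep G T \<phi> g \<nu> w) = 0"
  using assms by (cases "w \<in> verts T") (simp_all add: tree_rep_def annihilates_def pairing_def[of _ "\<lambda>g. 0"])

lemma not_faithful_of_annihilator:
  assumes "Poly_Mapping.keys a \<subseteq> carrier G" "a \<noteq> 0" "\<And>w. w \<in> verts T \<Longrightarrow> annihilates G \<phi> a w"
  shows "\<not> inj_on (algebra_rep (verts T) (tree_rep G T \<phi>)) (group_algebra G)"
proof
  assume inj: "inj_on (algebra_rep (verts T) (tree_rep G T \<phi>)) (group_algebra G)"
  have "algebra_rep (verts T) (tree_rep G T \<phi>) a = algebra_rep (verts T) (tree_rep G T \<phi>) 0"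
    using annihilates_imp_tree_rep_zero[OF assms(3)] by (simp add: algebra_rep_def pairing_def)
  then show False
    using inj assms(1,2) by (auto dest!: inj_onD simp: group_algebra_def)
qed

section \<open>Subtree stabilizers and faithfulness\<close>

text \<open>The sets to be annihilated are, for each vertex \<open>u\<close> of the level of \<open>v\<close>, the subtree below \<open>u\<close>
  together with the finite set \<open>F\<close> of vertices of that level and the ones above it. The elements that
  fix \<open>F\<close> pointwise preserve all of these sets.\<close>
lemma exists_annihilator_of_infinite_subtree_stabilizer:
  assumes levels: "\<And>m. finite (level T m)" and trans: "spherically_transitive G T \<phi>"
    and v: "v \<in> verts T" and inf: "infinite (subtree_stabilizer G T \<phi> v)"
  shows "\<exists>a. Poly_Mapping.keys a \<subseteq> carrier G \<and> Poly_Mapping.lookup a \<one> = 1 \<and>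
    (\<forall>w\<in>verts T. annihilates G \<phi> a w)"
proof -
  define n where "n = graph_dist T (root T) v"
  have vn: "v \<in> level T n" using v by (simp add: level_def n_def)
  define F where "F = (\<Union>m\<le>n. level T m)"
  define N where "N = {g \<in> carrier G. \<forall>w\<in>F. \<phi> g w = w}"
  have F: "finite F" "F \<subseteq> verts T" "\<And>g w. g \<in> carrier G \<Longrightarrow> w \<in> F \<Longrightarrow> \<phi> g w \<in> F"
    using levels level_image by (auto simp: F_def level_def)
  have N: "subgroup N G" unfolding N_def using F(2) by (rule pointwise_stabilizer_subgroup)
  define S where "S u = subtree_stabilizer G T \<phi> u \<inter> N" for u
  define D where "D u = descendants T u \<union> F" for u
  have "infinite (S u)" if u: "u \<in> level T n" for u
  proof -
    obtain h where h: "h \<in> carrier G" "\<phi> h v = u"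
      using trans vn u unfolding spherically_transitive_def by blast
    let ?c = "\<lambda>x. h \<otimes> x \<otimes> inv h"
    have "inj_on ?c (subtree_stabilizer G T \<phi> v)"
      using h by (auto simp: inj_on_def subtree_stabilizer_def)
    then have "infinite (?c ` subtree_stabilizer G T \<phi> v)" using inf finite_imageD by blast
    moreover have "?c ` subtree_stabilizer G T \<phi> v \<subseteq> subtree_stabilizer G T \<phi> u"
      using subtree_stabilizer_conj[OF h(1) v] h(2) by auto
    ultimately have "infinite (subtree_stabilizer G T \<phi> u)" using finite_subset by blast
    then show ?thesis
      unfolding S_def N_def
      by (intro infinite_Int_pointwise_stabilizer subtree_stabilizer_subgroup F)
  qed
  moreover have "\<phi> g w \<in> D u" if "u \<in> level T n" "g \<in> N" "w \<in> D u" for u g w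
  proof -
    have "g \<in> carrier G" "\<phi> g u = u" using that by (auto simp: N_def F_def)
    then show ?thesis using descendants_image[of g w u] F(3) that(3) by (auto simp: D_def)
  qed
  moreover have "\<phi> x w = w" if "x \<in> S u" "w \<in> D u" for u x w
    using that by (auto simp: S_def N_def D_def subtree_stabilizer_def)
  moreover have "S u \<subseteq> N" "D u \<subseteq> verts T" for u
    using F(2) by (auto simp: S_def D_def descendants_def)
  ultimately have "\<exists>a. Poly_Mapping.keys a \<subseteq> N \<and> Poly_Mapping.lookup a \<one> = 1 \<and>
      (\<forall>u\<in>level T n. \<forall>w\<in>D u. annihilates G \<phi> a w)"
    by (intro exists_annihilator[OF levels N, where S = S]) blast
  then obtain a where a: "Poly_Mapping.keys a \<subseteq> N" "Poly_Mapping.lookup a \<one> = 1"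
      "\<forall>u\<in>level T n. \<forall>w\<in>D u. annihilates G \<phi> a w"
    by blast
  moreover have "\<exists>u\<in>level T n. w \<in> D u" if "w \<in> verts T" for w
  proof (cases "graph_dist T (root T) w \<le> n")
    case True
    then show ?thesis using that vn by (auto simp: D_def F_def level_def)
  next
    case False
    then show ?thesis using descendant_of_level[OF that, of n] by (auto simp: D_def)
  qed
  ultimately show ?thesis unfolding N_def by blast
qed

text \<open>A central element equals its conjugates, so it fixes all subtrees that start at the level of \<open>v\<close>;
  the vertices above are their ancestors.\<close>
lemma central_subtree_stabilizer_fixes_all:
  assumes trans: "spherically_transitive G T \<phi>" and v: "v \<in> verts T"
    and k: "k \<in> subtree_stabilizer G T \<phi> v" "k \<in> group_center G" and w: "w \<in> verts T"
  shows "\<phi> k w = w"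
proof -
  define n where "n = graph_dist T (root T) v"
  have vn: "v \<in> level T n" using v by (simp add: level_def n_def)
  have kG: "k \<in> carrier G" using k by (simp add: group_center_def)
  have deep: "\<phi> k x = x" if x: "x \<in> verts T" "n \<le> graph_dist T (root T) x" for x
  proof -
    obtain u where u: "u \<in> level T n" "x \<in> descendants T u"
      using descendant_of_level[OF x] by blast
    obtain h where h: "h \<in> carrier G" "\<phi> h v = u"
      using trans vn u unfolding spherically_transitive_def by blast
    have "k \<otimes> h = h \<otimes> k" using k(2) h(1) by (simp add: group_center_def)
    then have "h \<otimes> k \<otimes> inv h = k" using m_assoc[of k h "inv h"] h(1) kG by simp
    then have "k \<in> subtree_stabilizer G T \<phi> u"
      using subtree_stabilizer_conj[OF h(1) v k(1)] h(2) by simp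
    then show ?thesis using u by (simp add: subtree_stabilizer_def)
  qed
  show ?thesis
  proof (cases "graph_dist T (root T) w \<le> n")
    case True
    show ?thesis
    proof (rule fixes_ancestors_of_level[OF trans vn kG _ True])
      show "\<phi> k x = x" if "x \<in> level T n" for x using deep that by (simp add: level_def)
    qed (use w in \<open>simp add: level_def\<close>)
  qed (use deep w in simp)
qed

lemma exists_annihilator_of_kernel_element:
  assumes k: "k \<in> carrier G" "k \<noteq> \<one>" "\<And>w. w \<in> verts T \<Longrightarrow> \<phi> k w = w"
  shows "\<exists>a. Poly_Mapping.keys a \<subseteq> carrier G \<and> Poly_Mapping.lookup a \<one> = 1 \<and>
    (\<forall>w\<in>verts T. annihilates G \<phi> a w)"
proof (intro exI conjI ballI)
  let ?e = "Poly_Mapping.single \<one> 1 :: _ \<Rightarrow>\<^sub>0 complex"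
  show "Poly_Mapping.keys (times_one_minus G ?e k) \<subseteq> carrier G"
    using keys_times_one_minus[of G ?e k] k(1) by auto
  show "Poly_Mapping.lookup (times_one_minus G ?e k) \<one> = 1"
    using lookup_one_times_one_minus[of ?e k] k(1,2) by (simp add: inv_eq_1_iff)
  show "annihilates G \<phi> (times_one_minus G ?e k) w" if "w \<in> verts T" for w
    by (rule annihilates_times_one_minus) (use k that image_closed in auto)
qed

text \<open>The normalizer contains the stabilizer of \<open>v\<close>, which has finite index because the orbit of \<open>v\<close>
  lies in a single finite level.\<close>
lemma finite_subtree_stabilizer_central:
  assumes levels: "\<And>m. finite (level T m)" and v: "v \<in> verts T"
    and fin: "finite (subtree_stabilizer G T \<phi> v)"
    and normalizers: "\<And>H. subgroup H G \<Longrightarrow> finite H \<Longrightarrow> \<not> H \<subseteq> group_center G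
                        \<Longrightarrow> infinite (rcosets (normalizer G H))"
  shows "subtree_stabilizer G T \<phi> v \<subseteq> group_center G"
proof (rule ccontr)
  assume "\<not> subtree_stabilizer G T \<phi> v \<subseteq> group_center G"
  then have "infinite (rcosets (normalizer G (subtree_stabilizer G T \<phi> v)))"
    using normalizers subtree_stabilizer_subgroup fin by blast
  moreover have "finite (orbit G \<phi> v)"
    using level_image[of _ v "graph_dist T (root T) v"] v
    by (intro finite_subset[OF _ levels[of "graph_dist T (root T) v"]])
      (auto simp: orbit_def level_def)
  then have "finite (rcosets (normalizer G (subtree_stabilizer G T \<phi> v)))"
    using stabilizer_le_normalizer[OF v] v
    by (intro finite_rcosets_of_finite_orbit[of v] normalizer_imp_subgroup)
      (auto simp: subtree_stabilizer_def)
  ultimately show False by blast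
qed

end

theorem theorem5p1:
  fixes G :: "('g, 'm) monoid_scheme" (structure)
    and d :: "nat \<Rightarrow> nat"
    and T :: "'v rooted_graph"
    and \<phi> :: "'g \<Rightarrow> 'v \<Rightarrow> 'v"
  assumes "group G" and "countable (carrier G)"
    and normalizers: "\<And>H. subgroup H G \<Longrightarrow> finite H \<Longrightarrow> \<not> H \<subseteq> group_center G
                        \<Longrightarrow> infinite (rcosets (normalizer G H))"
    and "rooted_tree d T"
    and "tree_action G T \<phi>"
    and "spherically_transitive G T \<phi>"
    and "\<exists>v\<in>verts T. subtree_stabilizer G T \<phi> v \<noteq> {\<one>}"
  shows "\<not> inj_on (algebra_rep (verts T) (tree_rep G T \<phi>)) (group_algebra G)
       \<and> \<not> weakly_contained G (ell2 (carrier G)) ell2_inner (regular_rep G)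
             (ell2 (verts T)) ell2_inner (tree_rep G T \<phi>)"
proof -
  interpret group_action G "verts T" \<phi> using \<open>tree_action G T \<phi>\<close> by (simp add: tree_action_def)
  interpret tree_group_action G T \<phi>
    using \<open>tree_action G T \<phi>\<close> \<open>rooted_tree d T\<close>
    by unfold_locales (auto simp: tree_action_def rooted_tree_def)
  have levels: "finite (level T m)" for m using finite_level \<open>rooted_tree d T\<close> .
  obtain v where v: "v \<in> verts T" and nontrivial: "subtree_stabilizer G T \<phi> v \<noteq> {\<one>}"
    using assms(7) by blast
  have "\<exists>a. Poly_Mapping.keys a \<subseteq> carrier G \<and> Poly_Mapping.lookup a \<one> = 1 \<and>
    (\<forall>w\<in>verts T. annihilates G \<phi> a w)"
  proof (cases "finite (subtree_stabilizer G T \<phi> v)")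
    case True
    obtain k where k: "k \<in> subtree_stabilizer G T \<phi> v" "k \<noteq> \<one>"
      using nontrivial subgroup.one_closed[OF subtree_stabilizer_subgroup[of v]] by blast
    have center: "k \<in> group_center G"
      using finite_subtree_stabilizer_central[OF levels v True normalizers] k(1) by blast
    show ?thesis
    proof (rule exists_annihilator_of_kernel_element[OF _ k(2)])
      show "k \<in> carrier G" using center by (simp add: group_center_def)
    qed (rule central_subtree_stabilizer_fixes_all[OF \<open>spherically_transitive G T \<phi>\<close> v k(1) center])
  next
    case False
    then show ?thesis
      using exists_annihilator_of_infinite_subtree_stabilizer levels v
        \<open>spherically_transitive G T \<phi>\<close> by blast
  qed
  then obtain a where a: "Poly_Mapping.keys a \<subseteq> carrier G" "Poly_Mapping.lookup a \<one> = 1"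
      "\<And>w. w \<in> verts T \<Longrightarrow> annihilates G \<phi> a w"
    by blast
  have "a \<noteq> 0" using a(2) by auto
  then show ?thesis
    using not_faithful_of_annihilator[OF a(1) _ a(3)]
      not_weakly_contained_of_annihilator[OF a(1) _ tree_rep_in_ell2
        annihilates_imp_tree_rep_zero[OF a(3)]] a(2) by simp
qed

end
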